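(* Let $H=(V_H,E_H,w_H)$ be a hypergraph with $n$ vertices, let $\nu_2(H)$ be the second smallest eigenvalue of its normalized Laplacian $\mathcal{L}_H$, let $r\in\mathbb{R}^{V_H}$ be an eigenvector of $\mathcal{L}_H$ for $\nu_2(H)$ orthogonal to the vector $(\sqrt{d_H(u)})_{u\in V_H}$, and let $x=D_H^{-1/2}r$. Order the vertices as $v_1,\dots,v_n$ so that $x(v_1)\ge x(v_2)\ge\dots\ge x(v_n)$, and let $S$ be a sweep cut of minimum conductance, i.e. a set minimizing $\phi_h$ among the sets $\{v_1,\dots,v_i\}$, $1\le i\le n-1$ (this is the output of the spectral two-way partitioning algorithm). Then $$\phi_h(H)\ \le\ \phi_h(S)\ \le\ 2\sqrt{\hat\phi_h(H)}.$$
   Context: A hypergraph $H=(V_H,E_H,w_H)$ consists of a nonempty finite vertex set $V_H$, a finite set $E_H\subseteq 2^{V_H}$ of hyperedges, each of size at least $2$, and a weight function $w_H:E_H\to[0,\infty)$. Hyperedges may have different sizes. The degree of $u$ is $d_H(u)=\sum_{e\in E_H:\,u\in e}w_H(e)$; all degrees are assumed positive. For $S\subseteq V_H$ let $\mathrm{vol}_H(S)=\sum_{v\in S}d_H(v)$ and $\partial_h(S)=\{e\in E_H: e\cap S\ne\emptyset,\ e\cap(V_H\setminus S)\neq\emptyset\}$. For $\emptyset\subsetneq S\subsetneq V_H$ the conductance and the diffusion conductance of $S$ are $$\phi_h(S)=\frac{\sum_{e\in\partial_h(S)}w_H(e)}{\min(\mathrm{vol}_H(S),\mathrm{vol}_H(V_H\setminus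 S))},\qquad \hat\phi_h(S)=\frac{\sum_{e\in\partial_h(S)}\frac{w_H(e)}{|e|-1}|e\cap S||e\cap(V_H\setminus S)|}{\min(\mathrm{vol}_H(S),\mathrm{vol}_H(V_H\setminus S))},$$ and $\phi_h(H)$, $\hat\phi_h(H)$ are the minima of $\phi_h(S)$, $\hat\phi_h(S)$ over all $\emptyset\subsetneq S\subsetneq V_H$. The adjacency matrix is $A_H[u,v]=\sum_{e\in E_H:\{u,v\}\subseteq e}\frac{w_H(e)}{|e|-1}$ for $u\ne v$ and $A_H[u,u]=0$. $D_H$ is the diagonal matrix of degrees, $L_H=D_H-A_H$, and $\mathcal{L}_H=D_H^{-1/2}L_HD_H^{-1/2}$, with eigenvalues $\nu_1(H)\le\nu_2(H)\le\dots\le\nu_n(H)$ counted with multiplicity. *)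

theory Defs
  imports "HOL-Analysis.Analysis" "HOL-Computational_Algebra.Computational_Algebra"
begin

(* The vertex set is UNIV of an arbitrary finite type 'v.  The weight function is total, but
   only its values on hyperedges are ever used. *)
record 'v hypergraph =
  hedges :: "'v set set"
  weight :: "'v set \<Rightarrow> real"

definition degree_of :: "'v::finite hypergraph \<Rightarrow> 'v \<Rightarrow> real" where
  "degree_of H u = (\<Sum>e\<in>{e \<in> hedges H. u \<in> e}. weight H e)"

definition is_hypergraph :: "'v::finite hypergraph \<Rightarrow> bool" where
  "is_hypergraph H \<longleftrightarrow>
     (\<forall>e\<in>hedges H. 2 \<le> card e) \<and>
     (\<forall>e\<in>hedges H. 0 \<le> weight H e) \<and>
     (\<forall>u. 0 < degree_of H u)"

definition vol :: "'v::finite hypergraph \<Rightarrow> 'v set \<Rightarrow> real" where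
  "vol H S = (\<Sum>u\<in>S. degree_of H u)"

definition boundary :: "'v::finite hypergraph \<Rightarrow> 'v set \<Rightarrow> 'v set set" where
  "boundary H S = {e \<in> hedges H. e \<inter> S \<noteq> {} \<and> e \<inter> (UNIV - S) \<noteq> {}}"

definition conductance :: "'v::finite hypergraph \<Rightarrow> 'v set \<Rightarrow> real" where
  "conductance H S =
     (\<Sum>e\<in>boundary H S. weight H e) / min (vol H S) (vol H (UNIV - S))"

definition diffusion_conductance :: "'v::finite hypergraph \<Rightarrow> 'v set \<Rightarrow> real" where
  "diffusion_conductance H S =
     (\<Sum>e\<in>boundary H S. weight H e / (real (card e) - 1)
          * real (card (e \<inter> S)) * real (card (e \<inter> (UNIV - S))))
     / min (vol H S) (vol H (UNIV - S))"

definition hypergraph_conductance :: "'v::finite hypergraph \<Rightarrow> real" where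
  "hypergraph_conductance H = Min (conductance H ` {S. S \<noteq> {} \<and> S \<noteq> UNIV})"

definition hypergraph_diffusion_conductance :: "'v::finite hypergraph \<Rightarrow> real" where
  "hypergraph_diffusion_conductance H =
     Min (diffusion_conductance H ` {S. S \<noteq> {} \<and> S \<noteq> UNIV})"

definition adjacency_matrix :: "'v::finite hypergraph \<Rightarrow> real^'v^'v" where
  "adjacency_matrix H = (\<chi> u v. if u = v then 0
     else \<Sum>e\<in>{e \<in> hedges H. {u, v} \<subseteq> e}. weight H e / (real (card e) - 1))"

definition diagonal_matrix :: "('v::finite \<Rightarrow> real) \<Rightarrow> real^'v^'v" where
  "diagonal_matrix f = (\<chi> u v. if u = v then f u else 0)"

definition degree_matrix :: "'v::finite hypergraph \<Rightarrow> real^'v^'v" where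
  "degree_matrix H = diagonal_matrix (degree_of H)"

definition degree_matrix_inv_sqrt :: "'v::finite hypergraph \<Rightarrow> real^'v^'v" where
  "degree_matrix_inv_sqrt H = diagonal_matrix (\<lambda>u. 1 / sqrt (degree_of H u))"

definition laplacian :: "'v::finite hypergraph \<Rightarrow> real^'v^'v" where
  "laplacian H = degree_matrix H - adjacency_matrix H"

definition normalized_laplacian :: "'v::finite hypergraph \<Rightarrow> real^'v^'v" where
  "normalized_laplacian H =
     degree_matrix_inv_sqrt H ** laplacian H ** degree_matrix_inv_sqrt H"

definition charpoly :: "real^'n^'n \<Rightarrow> real poly" where
  "charpoly A = det (\<chi> i j. (if i = j then [:0, 1:] else 0) - [:A $ i $ j:])"

(* Real eigenvalues in increasing order, each repeated according to its multiplicity as a root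
   of the characteristic polynomial; for symmetric A the list has length CARD('n). *)
definition eigenvalue_list :: "real^'n^'n \<Rightarrow> real list" where
  "eigenvalue_list A = sorted_list_of_multiset (proots (charpoly A))"

(* nu H k is the k-th smallest eigenvalue, counted from k = 1; lists are indexed from 0. *)
definition nu :: "'v::finite hypergraph \<Rightarrow> nat \<Rightarrow> real" where
  "nu H k = eigenvalue_list (normalized_laplacian H) ! (k - 1)"

definition sweep_sets :: "(nat \<Rightarrow> 'v::finite) \<Rightarrow> 'v set set" where
  "sweep_sets v = {v ` {1..i} | i. 1 \<le> i \<and> i \<le> CARD('v) - 1}"

end

theory Submission
  imports Defs
begin

text \<open>
  Both conductances are compared with one weighted graph, the clique expansion: a hyperedge \<open>e\<close>
  becomes a clique whose edges have weight \<open>w e / (card e - 1)\<close>. This graph has the same degrees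
  as the hypergraph, its normalized Laplacian is that of the hypergraph, and the numerator of
  the diffusion conductance of \<open>T\<close> is exactly its cut at \<open>T\<close> (\<open>cut_weight_clique\<close>). The weight of
  the hyperedge boundary of \<open>T\<close> is at most that cut (\<open>boundary_weight_le_cut\<close>). The theorem is
  then Cheeger's inequality for this graph, in both directions:
  \<open>\<phi> S \<le> sqrt (2 \<nu>\<^sub>2)\<close> and \<open>\<nu>\<^sub>2 \<le> 2 min \<phi>'\<close>, with \<open>\<phi>\<close> the conductance and \<open>\<phi>'\<close> the diffusion
  conductance.

  For the upper bound on \<open>\<nu>\<^sub>2\<close> (\<open>nu_2_le_diffusion_conductance\<close>), a two-valued test vector for a
  set \<open>T\<close> is put into the Rayleigh quotient. Since \<open>\<nu>\<^sub>2\<close> is defined as the second entry of the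
  sorted list of roots of the characteristic polynomial, it has to be shown that this entry is
  at most the Rayleigh quotient of every vector orthogonal to the kernel vector
  (\<open>second_eigenvalue_rayleigh\<close>). A minimizer of the quotient is an eigenvector, so its
  eigenvalue is a root besides the root \<open>0\<close>; when it is itself \<open>0\<close>, as happens if some
  cut has weight \<open>0\<close>, the root \<open>0\<close> must be counted twice (\<open>charpoly_double_root\<close>).

  For the bound on the sweep cut (\<open>cheeger_sweep\<close>), let \<open>h\<close> be the smallest conductance of a
  sweep set. The positive or the negative part \<open>p\<close> of the eigenvector has a support of at most
  half of the total volume, so the superlevel sets of \<open>p\<close> have cut at least \<open>h\<close> times volume.
  Summing over the levels of \<open>p\<^sup>2\<close> (\<open>coarea_le\<close>) bounds the sum of \<open>a u w * \<bar>(p u)\<^sup>2 - (p w)\<^sup>2\<bar>\<close>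
  from below by \<open>2 h\<close> times \<open>N\<close>, the degree-weighted sum of \<open>p\<^sup>2\<close>. The Cauchy-Schwarz inequality
  bounds it from above by a multiple of the geometric mean of \<open>N\<close> and the energy of \<open>p\<close>, and
  that energy is at most \<open>\<nu>\<^sub>2 N\<close> (\<open>truncated_energy_le\<close>).
\<close>

text \<open>\<open>$\<close> also denotes coefficients of power series, which makes every matrix entry ambiguous.\<close>

no_notation fps_nth (infixl \<open>$\<close> 75)

section \<open>The second eigenvalue of a symmetric matrix\<close>

lemma inner_symmetric_matrix:
  fixes A :: "real^'n^'n"
  assumes "transpose A = A"
  shows "(A *v y) \<bullet> z = y \<bullet> (A *v z)"
  by (metis assms dot_lmul_matrix transpose_matrix_vector)

lemma det_zero_iff_kernel:
  fixes A :: "real^'n^'n"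
  shows "det A = 0 \<longleftrightarrow> (\<exists>y. y \<noteq> 0 \<and> A *v y = 0)"
  by (metis invertible_det_nz invertible_left_inverse matrix_left_invertible_ker)

lemma poly_det:
  fixes M :: "real poly^'n^'n"
  shows "poly (det M) t = det (\<chi> i j. poly (M $ i $ j) t)"
  by (simp add: det_def poly_sum poly_prod)

lemma poly_charpoly: "poly (charpoly A) t = det (mat t - A)"
  unfolding charpoly_def poly_det
  by (rule arg_cong[of _ _ det]) (simp add: vec_eq_iff mat_def)

lemma mat_mult_vec: "mat (t::real) *v y = t *\<^sub>R y"
  by (simp add: vec_eq_iff matrix_vector_mult_def mat_def if_distrib if_distribR cong: if_cong)

lemma charpoly_root_iff:
  "poly (charpoly A) t = 0 \<longleftrightarrow> (\<exists>y. y \<noteq> 0 \<and> A *v y = t *\<^sub>R y)"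
  by (auto simp: poly_charpoly det_zero_iff_kernel matrix_vector_mult_diff_rdistrib mat_mult_vec)

lemma charpoly_nonzero: "charpoly (A :: real^'n^'n) \<noteq> 0"
proof
  assume "charpoly A = 0"
  \<comment> \<open>every number would be an eigenvalue, also one beyond the operator norm\<close>
  then obtain y where y: "y \<noteq> 0" "A *v y = (onorm ((*v) A) + 1) *\<^sub>R y"
    by (metis charpoly_root_iff poly_0)
  have "norm (A *v y) \<le> onorm ((*v) A) * norm y"
    by (intro onorm matrix_vector_mul_bounded_linear)
  moreover have "0 \<le> onorm ((*v) A)"
    by (intro onorm_pos_le matrix_vector_mul_bounded_linear)
  ultimately show False
    using y by (simp add: distrib_right)
qed

text \<open>
  Geometric multiplicity two forces algebraic multiplicity two. If \<open>u $ i \<noteq> 0\<close>, then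
  replacing row \<open>i\<close> of \<open>X - A\<close> by the combination of all rows with coefficients \<open>u\<close> multiplies
  the determinant by \<open>u $ i\<close>. By symmetry of \<open>A\<close> the new row is \<open>X - \<lambda>\<close> times \<open>u\<close>, so one factor
  \<open>X - \<lambda>\<close> can be pulled out. What is left still vanishes at \<open>\<lambda>\<close>, because the second
  eigenvector, being orthogonal to \<open>u\<close>, is in the kernel there.
\<close>
lemma charpoly_double_root:
  fixes A :: "real^'n^'n"
  assumes sym: "transpose A = A"
    and u: "u \<noteq> 0" "A *v u = l *\<^sub>R u"
    and w: "w \<noteq> 0" "A *v w = l *\<^sub>R w"
    and orth: "u \<bullet> w = 0"
  shows "[:-l, 1:] ^ 2 dvd charpoly A"
proof -
  obtain i where i: "u $ i \<noteq> 0"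
    using u(1) by (auto simp: vec_eq_iff)
  define M :: "real poly^'n^'n" where
    "M = (\<chi> i j. (if i = j then [:0, 1:] else 0) - [:A $ i $ j:])"
  define U :: "real poly^'n" where "U = (\<chi> j. [:u $ j:])"
  define Q where "Q = (\<chi> k. if k = i then U else row k M)"
  have A_entry: "A $ j $ k = A $ k $ j" for j k
    using sym by (metis transpose_def vec_lambda_beta)
  have new_row: "(\<Sum>k\<in>UNIV. [:u $ k:] *s row k M) = [:-l, 1:] *s U"
  proof (rule iffD2[OF vec_eq_iff], rule allI)
    fix j
    have "(\<Sum>k\<in>UNIV. u $ k * A $ k $ j) = l * u $ j"
      using u(2) A_entry by (auto simp: vec_eq_iff matrix_vector_mult_def mult.commute)
    then have "(\<Sum>k\<in>UNIV. [:u $ k * A $ k $ j:]) = [:l * u $ j:]"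
      by (simp add: poly_eq_iff coeff_sum coeff_pCons split: nat.split)
    moreover have "(\<Sum>k\<in>UNIV. [:u $ k:] *s row k M) $ j
        = (\<Sum>k\<in>UNIV. (if k = j then [:0, u $ k:] else 0) - [:u $ k * A $ k $ j:])"
      by (auto simp: M_def row_def intro!: sum.cong)
    ultimately show "(\<Sum>k\<in>UNIV. [:u $ k:] *s row k M) $ j = ([:-l, 1:] *s U) $ j"
      by (simp add: sum_subtractf U_def)
  qed
  have "[:-l, 1:] * det Q = det (\<chi> k. if k = i then [:-l, 1:] *s U else row k M)"
    unfolding Q_def by (rule det_row_mul[symmetric])
  also have "\<dots> = (\<Sum>j\<in>UNIV. det (\<chi> k. if k = i then [:u $ j:] *s row j M else row k M))"
    unfolding new_row[symmetric] by (rule det_linear_row_sum) simp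
  also have "\<dots> = (\<Sum>j\<in>UNIV. [:u $ j:] * det (\<chi> k. if k = i then row j M else row k M))"
    by (simp add: det_row_mul)
  also have "\<dots> = (\<Sum>j\<in>UNIV. if j = i then [:u $ i:] * det M else 0)"
  proof (rule sum.cong[OF refl])
    fix j
    have "(\<chi> k. if k = i then row i M else row k M) = M"
      by (simp add: vec_eq_iff row_def)
    moreover have "det (\<chi> k. if k = i then row j M else row k M) = 0" if "j \<noteq> i"
      by (rule det_identical_rows[of i j]) (use that in \<open>auto simp: row_def vec_eq_iff\<close>)
    ultimately show "[:u $ j:] * det (\<chi> k. if k = i then row j M else row k M)
        = (if j = i then [:u $ i:] * det M else 0)"
      by (cases "j = i") (simp_all only: simp_thms if_True if_False mult_zero_right)
  qed
  also have "\<dots> = smult (u $ i) (charpoly A)"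
    by (simp add: charpoly_def M_def)
  finally have factor: "smult (u $ i) (charpoly A) = [:-l, 1:] * det Q" ..
  have "(\<chi> j k. poly (Q $ j $ k) l) *v w = 0"
  proof (rule iffD2[OF vec_eq_iff], rule allI)
    fix j
    have "(\<Sum>k\<in>UNIV. u $ k * w $ k) = 0"
      using orth by (simp add: inner_vec_def)
    moreover have "((mat l - A) *v w) $ j = 0"
      using w(2) by (simp add: matrix_vector_mult_diff_rdistrib mat_mult_vec)
    then have "(\<Sum>k\<in>UNIV. ((if j = k then l else 0) - A $ j $ k) * w $ k) = 0"
      by (simp add: matrix_vector_mult_def mat_def)
    moreover have "poly (Q $ j $ k) l = (if j = i then u $ k else (if j = k then l else 0) - A $ j $ k)" for k
      by (simp add: Q_def U_def M_def row_def)
    ultimately show "((\<chi> j k. poly (Q $ j $ k) l) *v w) $ j = 0 $ j"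
      by (cases "j = i") (simp_all only: matrix_vector_mult_def vec_lambda_beta simp_thms if_True if_False zero_index)
  qed
  then have "poly (det Q) l = 0"
    using w(1) by (auto simp: poly_det det_zero_iff_kernel)
  then have "[:-l, 1:] ^ 2 dvd smult (u $ i) (charpoly A)"
    unfolding factor power2_eq_square by (intro mult_dvd_mono) (auto simp: poly_eq_0_iff_dvd)
  then show ?thesis
    using i by (simp add: dvd_smult_iff)
qed

lemma sorted_second_le:
  fixes M :: "real multiset"
  assumes "{#a, b#} \<subseteq># M"
  shows "sorted_list_of_multiset M ! 1 \<le> max a b"
proof (rule ccontr)
  define xs where "xs = sorted_list_of_multiset M"
  assume "\<not> sorted_list_of_multiset M ! 1 \<le> max a b"
  then have large: "max a b < xs ! 1"
    unfolding xs_def by (rule not_le_imp_less)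
  have "size {#a, b#} \<le> size M"
    using assms by (rule size_mset_mono)
  then have "2 \<le> length xs"
    by (metis xs_def mset_sorted_list_of_multiset size_mset add_mset_add_single numeral_2_eq_2 size_add_mset size_empty)
  then obtain y z zs where xs: "xs = y # z # zs"
    by (metis One_nat_def Suc_le_length_iff numeral_2_eq_2)
  have "sorted xs"
    by (simp add: xs_def)
  then have "\<forall>t\<in>set (z # zs). max a b < t"
    using large xs by fastforce
  then have "filter (\<lambda>t. t \<le> max a b) (z # zs) = []"
    by (force simp: filter_empty_conv)
  then have "size (filter_mset (\<lambda>t. t \<le> max a b) (mset xs)) \<le> 1"
    unfolding xs mset_filter[symmetric] size_mset by simp
  moreover have "filter_mset (\<lambda>t. t \<le> max a b) {#a, b#} \<subseteq># filter_mset (\<lambda>t. t \<le> max a b) (mset xs)"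
    using assms by (intro multiset_filter_mono) (simp add: xs_def)
  then have "size (filter_mset (\<lambda>t. t \<le> max a b) {#a, b#}) \<le> size (filter_mset (\<lambda>t. t \<le> max a b) (mset xs))"
    by (rule size_mset_mono)
  ultimately show False by simp
qed

lemma second_eigenvalue_le:
  fixes A :: "real^'n^'n"
  assumes sym: "transpose A = A"
    and u: "u \<noteq> 0" "A *v u = l *\<^sub>R u"
    and w: "w \<noteq> 0" "A *v w = m *\<^sub>R w"
    and orth: "u \<bullet> w = 0"
  shows "eigenvalue_list A ! 1 \<le> max l m"
proof -
  have "{#l, m#} \<subseteq># proots (charpoly A)"
  proof (cases "l = m")
    case True
    have "2 \<le> order l (charpoly A)"
      using charpoly_double_root[OF sym u, of w] w orth True
      by (simp add: order_divides charpoly_nonzero)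
    then show ?thesis
      using True by (simp add: subseteq_mset_def charpoly_nonzero)
  next
    case False
    have "0 < order l (charpoly A)" "0 < order m (charpoly A)"
      using u w by (auto simp: order_gt_0_iff charpoly_nonzero charpoly_root_iff)
    then show ?thesis
      using False by (auto simp: subseteq_mset_def Suc_le_eq charpoly_nonzero)
  qed
  then show ?thesis
    unfolding eigenvalue_list_def by (rule sorted_second_le)
qed

text \<open>
  Minimizing the Rayleigh quotient over the unit sphere of the complement of \<open>u\<close> produces an
  eigenvector: at a minimizer the first variation vanishes in every direction orthogonal to \<open>u\<close>,
  and the residual is such a direction because the complement of an eigenvector is invariant.
\<close>
lemma rayleigh_minimizer_orthogonal:
  fixes A :: "real^'n^'n"
  assumes sym: "transpose A = A"
    and u: "A *v u = l *\<^sub>R u"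
    and z: "z \<noteq> 0" "u \<bullet> z = 0"
  obtains w m where "w \<noteq> 0" "u \<bullet> w = 0" "A *v w = m *\<^sub>R w"
    "\<And>y. u \<bullet> y = 0 \<Longrightarrow> m * (y \<bullet> y) \<le> y \<bullet> (A *v y)"
proof -
  define K where "K = sphere 0 1 \<inter> {y. u \<bullet> y = 0}"
  have "compact K"
    unfolding K_def by (intro compact_Int_closed compact_sphere closed_hyperplane)
  moreover have "z /\<^sub>R norm z \<in> K"
    using z by (simp add: K_def)
  moreover have "continuous_on K (\<lambda>y. y \<bullet> (A *v y))"
    by (intro continuous_intros matrix_vector_mult_linear_continuous_on)
  ultimately obtain w where w: "w \<in> K" "\<And>y. y \<in> K \<Longrightarrow> w \<bullet> (A *v w) \<le> y \<bullet> (A *v y)"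
    by (metis continuous_attains_inf empty_iff)
  define m where "m = w \<bullet> (A *v w)"
  have w1: "w \<bullet> w = 1" "u \<bullet> w = 0"
    using w(1) by (auto simp: K_def norm_eq_1)
  have min: "m * (y \<bullet> y) \<le> y \<bullet> (A *v y)" if "u \<bullet> y = 0" for y
  proof (cases "y = 0")
    case False
    then have "m \<le> (y /\<^sub>R norm y) \<bullet> (A *v (y /\<^sub>R norm y))"
      unfolding m_def using that by (intro w(2)) (simp add: K_def)
    also have "\<dots> = (y \<bullet> (A *v y)) / (y \<bullet> y)"
      by (simp add: matrix_vector_mult_scaleR dot_square_norm power2_eq_square divide_simps)
    finally show ?thesis
      using False by (simp add: pos_le_divide_eq)
  qed simp
  \<comment> \<open>the residual, which is to be shown to vanish\<close>
  define p where "p = A *v w - m *\<^sub>R w"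
  have "u \<bullet> (A *v w) = 0"
    using inner_symmetric_matrix[OF sym, of u w] w1 by (simp add: u)
  then have up: "u \<bullet> p = 0"
    using w1 by (simp add: p_def inner_diff_right)
  define q where "q = p \<bullet> (A *v p) - m * (p \<bullet> p)"
  have Aw: "A *v w = p + m *\<^sub>R w"
    by (simp add: p_def)
  have wp: "w \<bullet> p = 0"
    by (simp add: p_def inner_diff_right w1 m_def)
  have q: "0 \<le> q * t\<^sup>2 + 2 * (p \<bullet> p) * t" for t
  proof -
    have "m * ((w + t *\<^sub>R p) \<bullet> (w + t *\<^sub>R p)) \<le> (w + t *\<^sub>R p) \<bullet> (A *v (w + t *\<^sub>R p))"
      by (intro min) (simp add: inner_add_right w1 up)
    moreover have "w \<bullet> (A *v p) = p \<bullet> p"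
      using inner_symmetric_matrix[OF sym, of w p] wp by (simp add: Aw inner_add_left)
    ultimately show ?thesis
      using wp w1 by (simp add: q_def matrix_vector_right_distrib matrix_vector_mult_scaleR
          inner_add_left inner_add_right inner_commute[of p w] Aw power2_eq_square algebra_simps)
  qed
  have "p \<bullet> p = 0"
  proof (rule ccontr)
    assume "p \<bullet> p \<noteq> 0"
    then have pos: "0 < p \<bullet> p"
      by simp
    \<comment> \<open>a step short enough for the linear term to outweigh the quadratic one, so that moving against \<open>p\<close> lowers the quotient\<close>
    define s where "s = (p \<bullet> p) / (\<bar>q\<bar> + 1)"
    have s: "0 < s" "q * s \<le> p \<bullet> p"
      using pos mult_right_mono[of q "\<bar>q\<bar> + 1" "p \<bullet> p"]
      by (auto simp: s_def pos_divide_le_eq mult.commute add_pos_nonneg)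
    have "0 \<le> s * (q * s - 2 * (p \<bullet> p))"
      using q[of "- s"] by (simp add: power2_eq_square algebra_simps)
    then show False
      using s pos by (simp add: zero_le_mult_iff)
  qed
  then have "A *v w = m *\<^sub>R w"
    by (simp add: Aw)
  moreover have "w \<noteq> 0"
    using w1 by auto
  ultimately show thesis
    using that min w1 by blast
qed

text \<open>
  The half of the Courant-Fischer principle that bounds \<open>\<nu>\<^sub>2\<close> from above. The eigenvalue \<open>0\<close> of
  \<open>u\<close> and the minimum of the Rayleigh quotient give two entries of the eigenvalue list, and the
  larger of them is the minimum.
\<close>
lemma second_eigenvalue_rayleigh:
  fixes A :: "real^'n^'n"
  assumes sym: "transpose A = A"
    and u: "u \<noteq> 0" "A *v u = 0"
    and psd: "\<And>y. 0 \<le> y \<bullet> (A *v y)"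
    and y: "u \<bullet> y = 0"
  shows "eigenvalue_list A ! 1 * (y \<bullet> y) \<le> y \<bullet> (A *v y)"
proof (cases "y = 0")
  case False
  obtain w m where w: "w \<noteq> 0" "u \<bullet> w = 0" "A *v w = m *\<^sub>R w"
    and min: "\<And>y. u \<bullet> y = 0 \<Longrightarrow> m * (y \<bullet> y) \<le> y \<bullet> (A *v y)"
    using rayleigh_minimizer_orthogonal[OF sym, of u 0 y] u y False by auto
  have "0 \<le> m * (w \<bullet> w)"
    using psd[of w] w(3) by simp
  then have "0 \<le> m"
    using w(1) by (metis inner_gt_zero_iff mult_neg_pos not_less)
  then have "eigenvalue_list A ! 1 \<le> m"
    using second_eigenvalue_le[OF sym, of u 0 w m] u w by simp
  then have "eigenvalue_list A ! 1 * (y \<bullet> y) \<le> m * (y \<bullet> y)"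
    by (intro mult_right_mono) auto
  also have "\<dots> \<le> y \<bullet> (A *v y)"
    using y by (rule min)
  finally show ?thesis .
qed simp

section \<open>Cheeger's inequality on a weighted graph\<close>

definition cut_weight :: "('v::finite \<Rightarrow> 'v \<Rightarrow> real) \<Rightarrow> 'v set \<Rightarrow> real" where
  "cut_weight a T = (\<Sum>u\<in>T. \<Sum>w\<in>-T. a u w)"

lemma cut_weight_indicator:
  "cut_weight a T = (\<Sum>u\<in>UNIV. \<Sum>w\<in>UNIV. a u w * (if u \<in> T \<and> w \<notin> T then 1 else 0))"
proof -
  have "cut_weight a T = (\<Sum>u\<in>UNIV. if u \<in> T then \<Sum>w\<in>UNIV. if w \<in> -T then a u w else 0 else 0)"
    unfolding cut_weight_def by (simp add: sum.If_cases Compl_eq)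
  also have "\<dots> = (\<Sum>u\<in>UNIV. \<Sum>w\<in>UNIV. a u w * (if u \<in> T \<and> w \<notin> T then 1 else 0))"
    by (auto intro!: sum.cong)
  finally show ?thesis .
qed

lemma cut_weight_Compl:
  assumes "\<And>u w. a u w = a w u"
  shows "cut_weight a (- T) = cut_weight a T"
  unfolding cut_weight_def double_complement
  by (subst sum.swap) (simp add: assms)

text \<open>
  A discrete coarea inequality. Lowering \<open>g\<close> on its support by its least positive value \<open>m\<close>
  changes the two sides by \<open>m\<close> times the volume and \<open>m\<close> times the cut of the support, and the
  new function has the same superlevel sets (shifted by \<open>m\<close>) but a smaller support.
\<close>
lemma coarea_le:
  fixes g d :: "'v::finite \<Rightarrow> real"
  assumes "\<And>u. 0 \<le> g u"
    and "\<And>t. 0 \<le> t \<Longrightarrow> h * sum d {u. t < g u} \<le> cut_weight a {u. t < g u}"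
  shows "h * (\<Sum>u\<in>UNIV. d u * g u) \<le> (\<Sum>u\<in>UNIV. \<Sum>w\<in>UNIV. a u w * max 0 (g u - g w))"
  using assms
proof (induction "card {u. 0 < g u}" arbitrary: g rule: less_induct)
  case less
  define T where "T = {u. 0 < g u}"
  have off: "g u = 0" if "u \<notin> T" for u
    using that less.prems(1)[of u] by (simp add: T_def)
  show ?case
  proof (cases "T = {}")
    case True
    then have "g u = 0" for u
      using off by simp
    then show ?thesis by simp
  next
    case False
    define m where "m = Min (g ` T)"
    have "m \<in> g ` T"
      unfolding m_def using False by (intro Min_in) auto
    then obtain z where z: "z \<in> T" "g z = m" by auto
    then have m: "0 < m" by (simp add: T_def)
    have m_le: "m \<le> g u" if "u \<in> T" for u
      unfolding m_def using that by (intro Min_le) auto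
    define g' where "g' u = (if u \<in> T then g u - m else 0)" for u
    have level: "{u. t < g' u} = {u. t + m < g u}" if "0 \<le> t" for t
      using that m off by (force simp: g'_def)
    have "z \<notin> {u. 0 < g' u}" "{u. 0 < g' u} \<subseteq> T"
      using z by (auto simp: g'_def split: if_splits)
    then have "{u. 0 < g' u} \<subset> T"
      using z by blast
    then have "card {u. 0 < g' u} < card {u. 0 < g u}"
      unfolding T_def by (intro psubset_card_mono) auto
    moreover have "0 \<le> g' u" for u
      using m_le by (simp add: g'_def)
    moreover have "h * sum d {u. t < g' u} \<le> cut_weight a {u. t < g' u}" if "0 \<le> t" for t
      using less.prems(2)[of "t + m"] that m by (simp add: level)
    ultimately have IH: "h * (\<Sum>u\<in>UNIV. d u * g' u)
        \<le> (\<Sum>u\<in>UNIV. \<Sum>w\<in>UNIV. a u w * max 0 (g' u - g' w))"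
      by (rule less.hyps)
    have "(\<Sum>u\<in>UNIV. d u * g u) = (\<Sum>u\<in>UNIV. d u * g' u + (if u \<in> T then m * d u else 0))"
      using off by (intro sum.cong) (auto simp: g'_def algebra_simps)
    also have "\<dots> = (\<Sum>u\<in>UNIV. d u * g' u) + m * sum d T"
      by (simp add: sum.distrib sum.If_cases sum_distrib_left)
    finally have vol: "(\<Sum>u\<in>UNIV. d u * g u) = (\<Sum>u\<in>UNIV. d u * g' u) + m * sum d T" .
    have "(\<Sum>u\<in>UNIV. \<Sum>w\<in>UNIV. a u w * max 0 (g u - g w))
        = (\<Sum>u\<in>UNIV. \<Sum>w\<in>UNIV. a u w * max 0 (g' u - g' w)
            + m * (a u w * (if u \<in> T \<and> w \<notin> T then 1 else 0)))"
    proof (intro sum.cong refl)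
      fix u w
      have "max 0 (g u - g w) = max 0 (g' u - g' w) + m * (if u \<in> T \<and> w \<notin> T then 1 else 0)"
        using off[of u] off[of w] m_le[of u] m_le[of w] m by (auto simp: g'_def)
      then show "a u w * max 0 (g u - g w) = a u w * max 0 (g' u - g' w)
            + m * (a u w * (if u \<in> T \<and> w \<notin> T then 1 else 0))"
        by (simp only: distrib_left mult.left_commute)
    qed
    also have "\<dots> = (\<Sum>u\<in>UNIV. \<Sum>w\<in>UNIV. a u w * max 0 (g' u - g' w)) + m * cut_weight a T"
      by (simp only: cut_weight_indicator sum.distrib sum_distrib_left)
    finally have "(\<Sum>u\<in>UNIV. \<Sum>w\<in>UNIV. a u w * max 0 (g u - g w))
        = (\<Sum>u\<in>UNIV. \<Sum>w\<in>UNIV. a u w * max 0 (g' u - g' w)) + m * cut_weight a T" .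
    moreover have "m * (h * sum d T) \<le> m * cut_weight a T"
      using less.prems(2)[of 0] m by (simp add: T_def)
    ultimately show ?thesis
      using IH by (simp add: vol algebra_simps)
  qed
qed

text \<open>
  The superlevel sets of \<open>p\<^sup>2\<close> are those of \<open>p\<close>, so the coarea inequality applies to \<open>p\<^sup>2\<close>. The
  factorization \<open>\<bar>(p u)\<^sup>2 - (p w)\<^sup>2\<bar> = \<bar>p u - p w\<bar> * (p u + p w)\<close> prepares the Cauchy-Schwarz
  inequality, and \<open>(p u + p w)\<^sup>2 \<le> 2 * (p u)\<^sup>2 + 2 * (p w)\<^sup>2\<close> bounds its second factor by four times
  the weighted norm of \<open>p\<close>.
\<close>
lemma cheeger_nonneg:
  fixes a :: "'v::finite \<Rightarrow> 'v \<Rightarrow> real"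
  assumes sym: "\<And>u w. a u w = a w u" and nonneg: "\<And>u w. 0 \<le> a u w"
    and deg: "\<And>u. d u = (\<Sum>w\<in>UNIV. a u w)"
    and p: "\<And>u. 0 \<le> p u"
    and h: "0 \<le> h"
    and level: "\<And>t. 0 \<le> t \<Longrightarrow> h * sum d {u. t < p u} \<le> cut_weight a {u. t < p u}"
  shows "h\<^sup>2 * (\<Sum>u\<in>UNIV. d u * (p u)\<^sup>2) \<le> (\<Sum>u\<in>UNIV. \<Sum>w\<in>UNIV. a u w * (p u - p w)\<^sup>2)"
    (is "h\<^sup>2 * ?P \<le> ?F")
proof -
  let ?E = "UNIV \<times> (UNIV :: 'v set)"
  let ?m = "\<Sum>u\<in>UNIV. \<Sum>w\<in>UNIV. a u w * max 0 ((p u)\<^sup>2 - (p w)\<^sup>2)"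
  let ?G = "\<Sum>u\<in>UNIV. \<Sum>w\<in>UNIV. a u w * (p u + p w)\<^sup>2"
  have "h * sum d {u. t < (p u)\<^sup>2} \<le> cut_weight a {u. t < (p u)\<^sup>2}" if "0 \<le> t" for t
  proof -
    have "{u. t < (p u)\<^sup>2} = {u. sqrt t < p u}"
      using real_sqrt_less_iff[of t "(p u)\<^sup>2" for u] p by simp
    then show ?thesis
      using level[of "sqrt t"] that by simp
  qed
  then have "h * ?P \<le> ?m"
    by (intro coarea_le) auto
  also have "2 * ?m = ?m + (\<Sum>u\<in>UNIV. \<Sum>w\<in>UNIV. a u w * max 0 ((p w)\<^sup>2 - (p u)\<^sup>2))"
    by (subst (2) sum.swap) (simp add: sym)
  then have "2 * ?m = (\<Sum>u\<in>UNIV. \<Sum>w\<in>UNIV. a u w * (\<bar>p u - p w\<bar> * (p u + p w)))"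
  proof -
    have "max 0 ((p u)\<^sup>2 - (p w)\<^sup>2) + max 0 ((p w)\<^sup>2 - (p u)\<^sup>2) = \<bar>p u - p w\<bar> * (p u + p w)" for u w
    proof -
      have "max 0 y + max 0 (- y) = \<bar>y\<bar>" for y :: real by auto
      from this[of "(p u)\<^sup>2 - (p w)\<^sup>2"] have "max 0 ((p u)\<^sup>2 - (p w)\<^sup>2) + max 0 ((p w)\<^sup>2 - (p u)\<^sup>2)
          = \<bar>(p u)\<^sup>2 - (p w)\<^sup>2\<bar>" by simp
      also have "\<dots> = \<bar>(p u - p w) * (p u + p w)\<bar>"
        by (simp add: power2_eq_square algebra_simps)
      finally show ?thesis
        using p[of u] p[of w] by (simp add: abs_mult)
    qed
    then show ?thesis
      unfolding \<open>2 * ?m = _\<close> sum.distrib[symmetric] distrib_left[symmetric] by simp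
  qed
  then have m: "?m = (\<Sum>u\<in>UNIV. \<Sum>w\<in>UNIV. a u w * (\<bar>p u - p w\<bar> * (p u + p w))) / 2"
    by simp
  finally have hP: "2 * (h * ?P) \<le> (\<Sum>u\<in>UNIV. \<Sum>w\<in>UNIV. a u w * (\<bar>p u - p w\<bar> * (p u + p w)))"
    by simp
  have split_weight: "a u w * (y * z) = (sqrt (a u w) * y) * (sqrt (a u w) * z)" for u w y z
  proof -
    have "(sqrt (a u w) * y) * (sqrt (a u w) * z) = (sqrt (a u w) * sqrt (a u w)) * (y * z)"
      by (simp only: mult_ac)
    then show ?thesis
      using nonneg[of u w] by simp
  qed
  have "(\<Sum>u\<in>UNIV. \<Sum>w\<in>UNIV. a u w * (\<bar>p u - p w\<bar> * (p u + p w)))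
      = (\<Sum>(u, w)\<in>?E. (sqrt (a u w) * \<bar>p u - p w\<bar>) * (sqrt (a u w) * (p u + p w)))"
    unfolding sum.cartesian_product split_weight ..
  also have "\<dots>\<^sup>2 \<le> (\<Sum>(u, w)\<in>?E. (sqrt (a u w) * \<bar>p u - p w\<bar>)\<^sup>2)
      * (\<Sum>(u, w)\<in>?E. (sqrt (a u w) * (p u + p w))\<^sup>2)"
    unfolding case_prod_unfold by (rule Cauchy_Schwarz_ineq_sum)
  also have "(\<Sum>(u, w)\<in>?E. (sqrt (a u w) * \<bar>p u - p w\<bar>)\<^sup>2) = ?F"
    by (simp add: sum.cartesian_product power_mult_distrib nonneg)
  also have "(\<Sum>(u, w)\<in>?E. (sqrt (a u w) * (p u + p w))\<^sup>2) = ?G"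
    by (simp add: sum.cartesian_product power_mult_distrib nonneg)
  finally have CS: "(\<Sum>u\<in>UNIV. \<Sum>w\<in>UNIV. a u w * (\<bar>p u - p w\<bar> * (p u + p w)))\<^sup>2 \<le> ?F * ?G" .
  have P: "0 \<le> ?P"
    using nonneg by (auto simp: deg intro!: sum_nonneg mult_nonneg_nonneg)
  have F: "0 \<le> ?F"
    using nonneg by (auto intro!: sum_nonneg)
  have "?G \<le> (\<Sum>u\<in>UNIV. \<Sum>w\<in>UNIV. 2 * (a u w * (p u)\<^sup>2) + 2 * (a u w * (p w)\<^sup>2))"
  proof (intro sum_mono)
    fix u w
    have "(p u + p w)\<^sup>2 \<le> 2 * (p u)\<^sup>2 + 2 * (p w)\<^sup>2"
      using zero_le_power2[of "p u - p w"] by (simp add: power2_eq_square algebra_simps)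
    from mult_left_mono[OF this nonneg[of u w]]
    show "a u w * (p u + p w)\<^sup>2 \<le> 2 * (a u w * (p u)\<^sup>2) + 2 * (a u w * (p w)\<^sup>2)"
      by (simp add: algebra_simps)
  qed
  also have "\<dots> = 2 * (\<Sum>u\<in>UNIV. \<Sum>w\<in>UNIV. a u w * (p u)\<^sup>2) + 2 * (\<Sum>u\<in>UNIV. \<Sum>w\<in>UNIV. a u w * (p w)\<^sup>2)"
    by (simp only: sum.distrib sum_distrib_left)
  also have "(\<Sum>u\<in>UNIV. \<Sum>w\<in>UNIV. a u w * (p w)\<^sup>2) = (\<Sum>u\<in>UNIV. \<Sum>w\<in>UNIV. a u w * (p u)\<^sup>2)"
    by (subst sum.swap) (simp add: sym)
  also have "(\<Sum>u\<in>UNIV. \<Sum>w\<in>UNIV. a u w * (p u)\<^sup>2) = ?P"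
    by (simp add: deg sum_distrib_right)
  finally have G: "?G \<le> 4 * ?P" by simp
  have "(2 * (h * ?P))\<^sup>2 \<le> (\<Sum>u\<in>UNIV. \<Sum>w\<in>UNIV. a u w * (\<bar>p u - p w\<bar> * (p u + p w)))\<^sup>2"
    using hP h P by (intro power_mono) auto
  also have "\<dots> \<le> ?F * ?G" by (rule CS)
  also have "\<dots> \<le> ?F * (4 * ?P)"
    using G F by (rule mult_left_mono)
  finally have "?P * (h\<^sup>2 * ?P) \<le> ?P * ?F"
    by (simp add: power2_eq_square algebra_simps)
  then show ?thesis
    using P F by (cases "?P = 0") (auto simp: mult_le_cancel_left)
qed

text \<open>
  Truncating an eigenfunction to its positive part does not increase the Rayleigh quotient: at
  a vertex where \<open>f > 0\<close>, raising the negative values of neighbours to \<open>0\<close> only decreases the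
  Laplacian there, and elsewhere the truncation is \<open>0\<close>.
\<close>
lemma truncated_energy_le:
  fixes a :: "'v::finite \<Rightarrow> 'v \<Rightarrow> real"
  assumes sym: "\<And>u w. a u w = a w u" and nonneg: "\<And>u w. 0 \<le> a u w"
    and eig: "\<And>u. (\<Sum>w\<in>UNIV. a u w * (f u - f w)) = \<nu> * d u * f u"
    and p: "\<And>u. p u = max 0 (f u)"
  shows "(\<Sum>u\<in>UNIV. \<Sum>w\<in>UNIV. a u w * (p u - p w)\<^sup>2) \<le> 2 * \<nu> * (\<Sum>u\<in>UNIV. d u * (p u)\<^sup>2)"
proof -
  have "(\<Sum>u\<in>UNIV. \<Sum>w\<in>UNIV. a u w * (p u - p w)\<^sup>2)
      = (\<Sum>u\<in>UNIV. \<Sum>w\<in>UNIV. a u w * (p u * (p u - p w)) + a u w * (p w * (p w - p u)))"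
    by (simp add: power2_eq_square algebra_simps)
  also have "\<dots> = (\<Sum>u\<in>UNIV. \<Sum>w\<in>UNIV. a u w * (p u * (p u - p w)))
      + (\<Sum>u\<in>UNIV. \<Sum>w\<in>UNIV. a u w * (p w * (p w - p u)))"
    by (simp only: sum.distrib)
  also have "(\<Sum>u\<in>UNIV. \<Sum>w\<in>UNIV. a u w * (p w * (p w - p u)))
      = (\<Sum>u\<in>UNIV. \<Sum>w\<in>UNIV. a u w * (p u * (p u - p w)))"
    by (subst sum.swap) (simp add: sym)
  finally have "(\<Sum>u\<in>UNIV. \<Sum>w\<in>UNIV. a u w * (p u - p w)\<^sup>2)
      = 2 * (\<Sum>u\<in>UNIV. \<Sum>w\<in>UNIV. a u w * (p u * (p u - p w)))"
    by simp
  also have "(\<Sum>u\<in>UNIV. \<Sum>w\<in>UNIV. a u w * (p u * (p u - p w)))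
      \<le> (\<Sum>u\<in>UNIV. \<Sum>w\<in>UNIV. a u w * (p u * (f u - f w)))"
  proof (intro sum_mono)
    fix u w
    have "p u * (p u - p w) \<le> p u * (f u - f w)"
      by (cases "0 \<le> f u") (auto simp: p intro!: mult_left_mono)
    then show "a u w * (p u * (p u - p w)) \<le> a u w * (p u * (f u - f w))"
      using nonneg by (rule mult_left_mono)
  qed
  also have "\<dots> = (\<Sum>u\<in>UNIV. p u * (\<Sum>w\<in>UNIV. a u w * (f u - f w)))"
    by (simp add: sum_distrib_left mult.left_commute)
  also have "\<dots> = \<nu> * (\<Sum>u\<in>UNIV. d u * (p u)\<^sup>2)"
    unfolding eig sum_distrib_left
    by (intro sum.cong) (auto simp: p max_def power2_eq_square)
  finally show ?thesis by simp
qed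

lemma cheeger_one_sided:
  fixes a :: "'v::finite \<Rightarrow> 'v \<Rightarrow> real"
  assumes sym: "\<And>u w. a u w = a w u" and nonneg: "\<And>u w. 0 \<le> a u w"
    and deg: "\<And>u. d u = (\<Sum>w\<in>UNIV. a u w)" and pos: "\<And>u. 0 < d u"
    and eig: "\<And>u. (\<Sum>w\<in>UNIV. a u w * (f u - f w)) = \<nu> * d u * f u"
    and h: "0 \<le> h"
    and level: "\<And>t. 0 \<le> t \<Longrightarrow> h * sum d {u. t < f u} \<le> cut_weight a {u. t < f u}"
    and z: "0 < f z"
  shows "h\<^sup>2 \<le> 2 * \<nu>"
proof -
  define p where "p u = max 0 (f u)" for u
  have "{u. t < p u} = {u. t < f u}" if "0 \<le> t" for t
    using that by (auto simp: p_def)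
  then have "h\<^sup>2 * (\<Sum>u\<in>UNIV. d u * (p u)\<^sup>2) \<le> (\<Sum>u\<in>UNIV. \<Sum>w\<in>UNIV. a u w * (p u - p w)\<^sup>2)"
    using level by (intro cheeger_nonneg sym nonneg deg h) (auto simp: p_def)
  also have "\<dots> \<le> 2 * \<nu> * (\<Sum>u\<in>UNIV. d u * (p u)\<^sup>2)"
    by (intro truncated_energy_le[where f = f] sym nonneg eig) (simp add: p_def)
  finally have "h\<^sup>2 * (\<Sum>u\<in>UNIV. d u * (p u)\<^sup>2) \<le> 2 * \<nu> * (\<Sum>u\<in>UNIV. d u * (p u)\<^sup>2)" .
  moreover have "0 < (\<Sum>u\<in>UNIV. d u * (p u)\<^sup>2)"
    by (rule sum_pos2[of _ z]) (use z pos in \<open>auto simp: p_def less_imp_le\<close>)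
  ultimately show ?thesis
    by (simp add: mult_le_cancel_right)
qed

text \<open>
  The positive and the negative part of \<open>f\<close> have disjoint supports, so one of them has at most
  half of the total volume; for subsets of that support the minimum in the conductance is their
  own volume. For the negative part the sets are complements of upper sets of \<open>f\<close>.
\<close>
lemma cheeger_sweep:
  fixes a :: "'v::finite \<Rightarrow> 'v \<Rightarrow> real"
  assumes sym: "\<And>u w. a u w = a w u" and nonneg: "\<And>u w. 0 \<le> a u w"
    and deg: "\<And>u. d u = (\<Sum>w\<in>UNIV. a u w)" and pos: "\<And>u. 0 < d u"
    and eig: "\<And>u. (\<Sum>w\<in>UNIV. a u w * (f u - f w)) = \<nu> * d u * f u"
    and balanced: "(\<Sum>u\<in>UNIV. d u * f u) = 0" and nz: "f y \<noteq> 0"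
    and h: "0 \<le> h"
    and sweep: "\<And>T. T \<noteq> {} \<Longrightarrow> T \<noteq> UNIV \<Longrightarrow> (\<And>u w. u \<in> T \<Longrightarrow> w \<notin> T \<Longrightarrow> f w < f u)
        \<Longrightarrow> h * min (sum d T) (sum d (- T)) \<le> cut_weight a T"
  shows "h\<^sup>2 \<le> 2 * \<nu>"
proof -
  have exists_pos: "\<exists>z. 0 < k z" if "(\<Sum>u\<in>UNIV. d u * k u) = 0" "k y \<noteq> 0" for k :: "'v \<Rightarrow> real"
  proof (rule ccontr)
    assume "\<nexists>z. 0 < k z"
    then have le: "k z \<le> 0" for z
      by (metis not_less)
    then have "\<forall>u\<in>UNIV. - (d u * k u) = 0"
      using that(1) pos
      by (subst sum_nonneg_eq_0_iff[symmetric]) (auto simp: sum_negf mult_nonneg_nonpos less_imp_le)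
    then show False
      using that(2) pos[of y] by (auto dest: spec[of _ y])
  qed
  obtain z1 where z1: "0 < f z1"
    using exists_pos[of f] balanced nz by auto
  obtain z2 where z2: "f z2 < 0"
    using exists_pos[of "\<lambda>u. - f u"] balanced nz by (auto simp: sum_negf)
  have mono: "sum d A \<le> sum d B" if "A \<subseteq> B" for A B
    using that pos by (intro sum_mono2) (auto simp: less_imp_le)
  show ?thesis
  proof (cases "sum d {u. 0 < f u} \<le> sum d {u. f u \<le> 0}")
    case True
    show ?thesis
    proof (rule cheeger_one_sided[of a d f \<nu> h z1])
      fix t :: real assume t: "0 \<le> t"
      let ?T = "{u. t < f u}"
      have "sum d ?T \<le> sum d {u. 0 < f u}" "sum d {u. f u \<le> 0} \<le> sum d (- ?T)"
        using t by (auto intro!: mono)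
      then have "min (sum d ?T) (sum d (- ?T)) = sum d ?T"
        using True by simp
      moreover have "h * min (sum d ?T) (sum d (- ?T)) \<le> cut_weight a ?T" if "?T \<noteq> {}"
      proof (rule sweep[OF that])
        have "z2 \<notin> ?T" using z2 t by simp
        then show "?T \<noteq> UNIV" by blast
      qed auto
      ultimately show "h * sum d ?T \<le> cut_weight a ?T"
        by (cases "?T = {}") (simp_all add: cut_weight_def)
    qed (use assms z1 in auto)
  next
    case False
    show ?thesis
    proof (rule cheeger_one_sided[of a d "\<lambda>u. - f u" \<nu> h z2])
      fix t :: real assume t: "0 \<le> t"
      let ?T = "{u. t < - f u}"
      have "sum d ?T \<le> sum d {u. f u \<le> 0}" "sum d {u. 0 < f u} \<le> sum d (- ?T)"
        using t by (auto intro!: mono)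
      then have "min (sum d (- ?T)) (sum d (- (- ?T))) = sum d ?T"
        using False by simp
      moreover have "h * min (sum d (- ?T)) (sum d (- (- ?T))) \<le> cut_weight a (- ?T)" if "?T \<noteq> {}"
      proof (rule sweep)
        have "z1 \<in> - ?T" using z1 t by simp
        then show "- ?T \<noteq> {}" by blast
      qed (use that in auto)
      ultimately show "h * sum d ?T \<le> cut_weight a ?T"
        by (cases "?T = {}") (simp_all add: cut_weight_def[of a "{}"] cut_weight_Compl[OF sym])
    next
      show "(\<Sum>w\<in>UNIV. a u w * (- f u - (- f w))) = \<nu> * d u * - f u" for u
      proof -
        have "(\<Sum>w\<in>UNIV. a u w * (- f u - (- f w))) = - (\<Sum>w\<in>UNIV. a u w * (f u - f w))"
          unfolding sum_negf[symmetric] by (simp add: algebra_simps)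
        then show ?thesis by (simp add: eig)
      qed
    qed (use assms z2 in auto)
  qed
qed

section \<open>The clique expansion of a hypergraph\<close>

abbreviation clique_weight :: "'v::finite hypergraph \<Rightarrow> 'v \<Rightarrow> 'v \<Rightarrow> real" where
  "clique_weight H u w \<equiv> adjacency_matrix H $ u $ w"

lemma clique_weight_sym: "clique_weight H u w = clique_weight H w u"
  by (simp add: adjacency_matrix_def insert_commute)

lemma clique_weight_edges:
  "clique_weight H u w = (\<Sum>e\<in>hedges H. weight H e / (real (card e) - 1) *
     (of_bool (u \<in> e) * of_bool (w \<in> e - {u})))"
proof (cases "u = w")
  case False
  have "clique_weight H u w = (\<Sum>e\<in>hedges H. if u \<in> e \<and> w \<in> e then weight H e / (real (card e) - 1) else 0)"
    using False by (simp add: adjacency_matrix_def sum.inter_filter)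
  then show ?thesis
    using False by (auto intro!: sum.cong)
qed (simp add: adjacency_matrix_def)

lemma clique_weight_nonneg:
  assumes "is_hypergraph H"
  shows "0 \<le> clique_weight H u w"
proof -
  have "0 \<le> weight H e / (real (card e) - 1)" if "e \<in> hedges H" for e
    using assms that unfolding is_hypergraph_def by (intro divide_nonneg_nonneg) force+
  then show ?thesis
    unfolding clique_weight_edges by (intro sum_nonneg mult_nonneg_nonneg) auto
qed

lemma sum_of_bool_mem: "(\<Sum>u\<in>A. of_bool (u \<in> e)) = real (card (e \<inter> (A :: 'v::finite set)))"
  by (simp add: of_bool_def sum.If_cases Int_commute)

text \<open>
  The normalization \<open>card e - 1\<close> is the number of neighbours that \<open>u\<close> gets from a hyperedge \<open>e\<close>,
  so \<open>e\<close> contributes its full weight to the degree.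
\<close>
lemma clique_degree:
  assumes "is_hypergraph H"
  shows "degree_of H u = (\<Sum>w\<in>UNIV. clique_weight H u w)"
proof -
  have "(\<Sum>w\<in>UNIV. clique_weight H u w)
      = (\<Sum>e\<in>hedges H. weight H e / (real (card e) - 1) *
          (of_bool (u \<in> e) * (\<Sum>w\<in>UNIV. of_bool (w \<in> e - {u}))))"
    unfolding clique_weight_edges sum_distrib_left by (rule sum.swap)
  also have "\<dots> = (\<Sum>e\<in>hedges H. if u \<in> e then weight H e else 0)"
  proof (intro sum.cong refl)
    fix e assume e: "e \<in> hedges H"
    have "2 \<le> card e"
      using assms e by (simp add: is_hypergraph_def)
    then show "weight H e / (real (card e) - 1) * (of_bool (u \<in> e) * (\<Sum>w\<in>UNIV. of_bool (w \<in> e - {u})))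
        = (if u \<in> e then weight H e else 0)"
      by (cases "u \<in> e") (simp_all only: sum_of_bool_mem Int_UNIV_right, simp_all add: of_nat_diff)
  qed
  also have "\<dots> = degree_of H u"
    by (simp add: degree_of_def sum.inter_filter)
  finally show ?thesis ..
qed

text \<open>
  A hyperedge contributes one clique edge for each pair of its vertices separated by \<open>T\<close>.
\<close>
lemma cut_weight_clique:
  "cut_weight (clique_weight H) T = (\<Sum>e\<in>boundary H T. weight H e / (real (card e) - 1)
     * real (card (e \<inter> T)) * real (card (e \<inter> (UNIV - T))))"
proof -
  have "cut_weight (clique_weight H) T = (\<Sum>u\<in>T. \<Sum>w\<in>-T. \<Sum>e\<in>hedges H.
      weight H e / (real (card e) - 1) * (of_bool (u \<in> e) * of_bool (w \<in> e)))"
    unfolding cut_weight_def clique_weight_edges by (intro sum.cong refl) auto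
  also have "\<dots> = (\<Sum>u\<in>T. \<Sum>e\<in>hedges H. \<Sum>w\<in>-T.
      weight H e / (real (card e) - 1) * (of_bool (u \<in> e) * of_bool (w \<in> e)))"
    by (intro sum.cong refl sum.swap)
  also have "\<dots> = (\<Sum>e\<in>hedges H. \<Sum>u\<in>T. \<Sum>w\<in>-T.
      weight H e / (real (card e) - 1) * (of_bool (u \<in> e) * of_bool (w \<in> e)))"
    by (rule sum.swap)
  also have "\<dots> = (\<Sum>e\<in>hedges H. weight H e / (real (card e) - 1)
      * ((\<Sum>u\<in>T. of_bool (u \<in> e)) * (\<Sum>w\<in>-T. of_bool (w \<in> e))))"
    by (simp only: sum_product, simp only: sum_distrib_left)
  also have "\<dots> = (\<Sum>e\<in>hedges H. weight H e / (real (card e) - 1)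
      * real (card (e \<inter> T)) * real (card (e \<inter> (UNIV - T))))"
    by (simp only: sum_of_bool_mem Compl_eq_Diff_UNIV mult.assoc)
  also have "\<dots> = (\<Sum>e\<in>boundary H T. weight H e / (real (card e) - 1)
      * real (card (e \<inter> T)) * real (card (e \<inter> (UNIV - T))))"
    by (rule sum.mono_neutral_right) (auto simp: boundary_def)
  finally show ?thesis .
qed

text \<open>
  A cut hyperedge split into parts of sizes \<open>p\<close> and \<open>q\<close> contributes \<open>p q / (p + q - 1) \<ge> 1\<close> times
  its weight to the cut of the clique expansion, because \<open>(p - 1) (q - 1) \<ge> 0\<close>.
\<close>
lemma boundary_weight_le_cut:
  assumes "is_hypergraph H"
  shows "(\<Sum>e\<in>boundary H T. weight H e) \<le> cut_weight (clique_weight H) T"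
  unfolding cut_weight_clique
proof (rule sum_mono)
  fix e assume e: "e \<in> boundary H T"
  let ?p = "card (e \<inter> T)" and ?q = "card (e \<inter> (UNIV - T))"
  have "1 \<le> ?p" "1 \<le> ?q"
    using e by (auto simp: boundary_def Suc_le_eq card_gt_0_iff)
  then have "0 \<le> (real ?p - 1) * (real ?q - 1)"
    by simp
  moreover have "card ((e \<inter> T) \<union> (e \<inter> (UNIV - T))) = ?p + ?q"
    by (rule card_Un_disjoint) auto
  then have "card e = ?p + ?q"
    by (simp flip: Int_Un_distrib)
  ultimately have "real (card e) - 1 \<le> real ?p * real ?q"
    by (simp add: algebra_simps)
  moreover have "2 \<le> card e" "0 \<le> weight H e"
    using assms e by (auto simp: is_hypergraph_def boundary_def)
  ultimately show "weight H e \<le> weight H e / (real (card e) - 1) * real ?p * real ?q"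
    by (simp add: pos_le_divide_eq mult_left_mono mult.assoc)
qed

section \<open>The normalized Laplacian\<close>

lemma diagonal_matrix_mult_vec: "diagonal_matrix k *v y = (\<chi> u. k u * y $ u)"
  by (simp add: diagonal_matrix_def matrix_vector_mult_def vec_eq_iff if_distrib if_distribR cong: if_cong)

lemma transpose_diagonal_matrix: "transpose (diagonal_matrix k) = diagonal_matrix k"
  by (simp add: diagonal_matrix_def transpose_def vec_eq_iff)

lemma laplacian_mult_vec:
  assumes "is_hypergraph H"
  shows "laplacian H *v f = (\<chi> u. \<Sum>w\<in>UNIV. clique_weight H u w * (f $ u - f $ w))"
  by (simp add: laplacian_def matrix_vector_mult_diff_rdistrib degree_matrix_def diagonal_matrix_mult_vec
      clique_degree[OF assms] vec_eq_iff right_diff_distrib sum_subtractf sum_distrib_right)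
    (simp add: matrix_vector_mult_def)

lemma normalized_laplacian_mult_vec:
  "normalized_laplacian H *v y
    = degree_matrix_inv_sqrt H *v (laplacian H *v (degree_matrix_inv_sqrt H *v y))"
  by (simp add: normalized_laplacian_def matrix_vector_mul_assoc matrix_mul_assoc)

lemma normalized_laplacian_sym: "transpose (normalized_laplacian H) = normalized_laplacian H"
proof -
  have "transpose (adjacency_matrix H) = adjacency_matrix H"
    by (simp add: transpose_def vec_eq_iff clique_weight_sym)
  then have "transpose (laplacian H) = laplacian H"
    using transpose_diagonal_matrix[of "degree_of H"]
    by (simp add: laplacian_def degree_matrix_def transpose_def vec_eq_iff)
  then show ?thesis
    by (simp add: normalized_laplacian_def matrix_transpose_mul degree_matrix_inv_sqrt_def
        transpose_diagonal_matrix matrix_mul_assoc)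
qed

lemma normalized_laplacian_quadratic_form:
  assumes "is_hypergraph H"
    and f: "f = degree_matrix_inv_sqrt H *v y"
  shows "y \<bullet> (normalized_laplacian H *v y)
    = (\<Sum>u\<in>UNIV. \<Sum>w\<in>UNIV. clique_weight H u w * (f $ u - f $ w)\<^sup>2) / 2"
proof -
  let ?a = "clique_weight H"
  have "y \<bullet> (normalized_laplacian H *v y) = f \<bullet> (laplacian H *v f)"
    unfolding normalized_laplacian_mult_vec f
    by (rule inner_symmetric_matrix[symmetric])
      (simp add: degree_matrix_inv_sqrt_def transpose_diagonal_matrix)
  also have "\<dots> = (\<Sum>u\<in>UNIV. \<Sum>w\<in>UNIV. ?a u w * (f $ u * (f $ u - f $ w)))"
    by (simp add: laplacian_mult_vec assms inner_vec_def sum_distrib_left mult.left_commute)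
  finally have 1: "y \<bullet> (normalized_laplacian H *v y) = (\<Sum>u\<in>UNIV. \<Sum>w\<in>UNIV. ?a u w * (f $ u * (f $ u - f $ w)))" .
  also have "\<dots> = (\<Sum>u\<in>UNIV. \<Sum>w\<in>UNIV. ?a u w * (f $ w * (f $ w - f $ u)))"
    by (subst sum.swap) (simp add: clique_weight_sym)
  finally have "2 * (y \<bullet> (normalized_laplacian H *v y))
      = (\<Sum>u\<in>UNIV. \<Sum>w\<in>UNIV. ?a u w * (f $ u * (f $ u - f $ w)) + ?a u w * (f $ w * (f $ w - f $ u)))"
    unfolding sum.distrib using 1 by linarith
  also have "\<dots> = (\<Sum>u\<in>UNIV. \<Sum>w\<in>UNIV. ?a u w * (f $ u - f $ w)\<^sup>2)"
    by (simp add: power2_eq_square algebra_simps)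
  finally show ?thesis by simp
qed

lemma normalized_laplacian_psd:
  assumes "is_hypergraph H"
  shows "0 \<le> y \<bullet> (normalized_laplacian H *v y)"
  unfolding normalized_laplacian_quadratic_form[OF assms refl]
  by (intro divide_nonneg_nonneg sum_nonneg mult_nonneg_nonneg clique_weight_nonneg assms) auto

lemma degree_pos: "is_hypergraph H \<Longrightarrow> 0 < degree_of H u"
  by (simp add: is_hypergraph_def)

lemma inv_sqrt_mult_sqrt_degree:
  assumes "is_hypergraph H"
  shows "degree_matrix_inv_sqrt H *v (\<chi> u. sqrt (degree_of H u) * k u) = (\<chi> u. k u)"
  using degree_pos[OF assms]
  by (simp add: degree_matrix_inv_sqrt_def diagonal_matrix_mult_vec vec_eq_iff) (metis less_numeral_extra(3))

lemma normalized_laplacian_kernel: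
  assumes "is_hypergraph H"
  shows "normalized_laplacian H *v (\<chi> u. sqrt (degree_of H u)) = 0"
  using inv_sqrt_mult_sqrt_degree[OF assms, of "\<lambda>_. 1"]
  by (simp add: normalized_laplacian_mult_vec laplacian_mult_vec[OF assms])
    (simp add: degree_matrix_inv_sqrt_def diagonal_matrix_mult_vec vec_eq_iff)

lemma vol_pos:
  assumes "is_hypergraph H" "T \<noteq> {}"
  shows "0 < vol H T"
  unfolding vol_def using assms by (intro sum_pos degree_pos) auto

text \<open>
  The test vector is constant on \<open>T\<close> and on its complement, with values in the ratio that makes it
  orthogonal to the kernel vector. Its Rayleigh quotient is the clique cut of \<open>T\<close> times
  \<open>(a + b) / (a b)\<close>, where \<open>a\<close> and \<open>b\<close> are the two volumes, and \<open>(a + b) / (a b) \<le> 2 / min a b\<close>.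
\<close>
lemma nu_2_le_diffusion_conductance:
  assumes H: "is_hypergraph H" and T: "T \<noteq> {}" "T \<noteq> UNIV"
  shows "nu H 2 \<le> 2 * diffusion_conductance H T"
proof -
  let ?a = "clique_weight H" and ?d = "degree_of H"
  define a where "a = vol H T"
  define b where "b = vol H (UNIV - T)"
  have pos: "0 < a" "0 < b"
    using T by (auto simp: a_def b_def intro!: vol_pos H)
  define k where "k u = (if u \<in> T then b else - a)" for u
  define s where "s = (\<chi> u. sqrt (?d u))"
  define y where "y = (\<chi> u. sqrt (?d u) * k u)"
  have sq: "sqrt (?d u) * sqrt (?d u) = ?d u" for u
    using degree_pos[OF H, of u] by simp
  have split_sum: "(\<Sum>u\<in>UNIV. ?d u * (if u \<in> T then p else q)) = a * p + b * q" for p q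
  proof -
    have "(\<Sum>u\<in>UNIV. ?d u * (if u \<in> T then p else q)) = (\<Sum>u\<in>UNIV. if u \<in> T then ?d u * p else ?d u * q)"
      by (intro sum.cong) auto
    then show ?thesis
      by (simp add: sum.If_cases a_def b_def vol_def sum_distrib_right Compl_eq_Diff_UNIV flip: Compl_eq)
  qed
  have "s \<bullet> y = (\<Sum>u\<in>UNIV. (sqrt (?d u) * sqrt (?d u)) * k u)"
    by (simp only: s_def y_def inner_vec_def inner_real_def vec_lambda_beta mult.assoc)
  then have orth: "s \<bullet> y = 0"
    unfolding sq k_def split_sum by (simp add: mult.commute)
  have "y \<bullet> y = (\<Sum>u\<in>UNIV. (sqrt (?d u) * sqrt (?d u)) * (k u)\<^sup>2)"
    by (simp add: y_def inner_vec_def power2_eq_square algebra_simps)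
  also have "\<dots> = (\<Sum>u\<in>UNIV. ?d u * (if u \<in> T then b\<^sup>2 else a\<^sup>2))"
    unfolding sq by (intro sum.cong) (auto simp: k_def)
  finally have norm: "y \<bullet> y = a * b\<^sup>2 + b * a\<^sup>2"
    unfolding split_sum .
  have "(\<Sum>u\<in>UNIV. \<Sum>w\<in>UNIV. ?a u w * (k u - k w)\<^sup>2)
      = (\<Sum>u\<in>UNIV. \<Sum>w\<in>UNIV. (a + b)\<^sup>2 * (?a u w * (if u \<in> T \<and> w \<notin> T then 1 else 0))
          + (a + b)\<^sup>2 * (?a w u * (if w \<in> T \<and> u \<notin> T then 1 else 0)))"
    by (intro sum.cong refl) (auto simp: k_def clique_weight_sym power2_eq_square algebra_simps)
  also have "\<dots> = (a + b)\<^sup>2 * cut_weight ?a T + (a + b)\<^sup>2 * cut_weight ?a T"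
    unfolding sum.distrib sum_distrib_left[symmetric] cut_weight_indicator
    by (subst (2) sum.swap) (rule refl)
  finally have energy: "(\<Sum>u\<in>UNIV. \<Sum>w\<in>UNIV. ?a u w * (k u - k w)\<^sup>2) / 2 = (a + b)\<^sup>2 * cut_weight ?a T"
    by simp
  have "s \<noteq> 0"
    using degree_pos[OF H] by (auto simp: s_def vec_eq_iff) (metis less_irrefl)
  then have "nu H 2 * (y \<bullet> y) \<le> y \<bullet> (normalized_laplacian H *v y)"
    using second_eigenvalue_rayleigh[OF normalized_laplacian_sym, of s H y]
      normalized_laplacian_kernel[OF H] normalized_laplacian_psd[OF H] orth
    by (simp add: nu_def s_def)
  also have "\<dots> = (a + b)\<^sup>2 * cut_weight ?a T"
    using normalized_laplacian_quadratic_form[OF H inv_sqrt_mult_sqrt_degree[OF H, symmetric], of k] energy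
    by (simp add: y_def)
  finally have "(a + b) * (nu H 2 * (a * b)) \<le> (a + b) * ((a + b) * cut_weight ?a T)"
    by (simp add: norm power2_eq_square algebra_simps)
  then have ray: "nu H 2 * (a * b) \<le> (a + b) * cut_weight ?a T"
    using pos by simp
  have cut: "0 \<le> cut_weight ?a T"
    unfolding cut_weight_def by (intro sum_nonneg clique_weight_nonneg H)
  have "max a b * (nu H 2 * min a b) = nu H 2 * (a * b)"
    by (simp add: min_def max_def)
  also have "\<dots> \<le> (2 * max a b) * cut_weight ?a T"
    using cut by (intro order_trans[OF ray] mult_right_mono) auto
  finally have "nu H 2 * min a b \<le> 2 * cut_weight ?a T"
    using pos by (simp add: max_def split: if_splits)
  then show ?thesis
    using pos by (simp add: diffusion_conductance_def pos_le_divide_eq cut_weight_clique a_def b_def)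
qed

section \<open>Sweep cuts\<close>

text \<open>
  The strict inequality in the hypothesis matters: ties in \<open>f\<close> are broken arbitrarily by the
  ordering \<open>v\<close>, so a set that separates two tied vertices may fail to be a prefix.
\<close>
lemma upper_set_in_sweep_sets:
  fixes v :: "nat \<Rightarrow> 'v::finite" and f :: "'v \<Rightarrow> real"
  assumes bij: "bij_betw v {1..CARD('v)} UNIV"
    and sorted: "\<And>i j. 1 \<le> i \<Longrightarrow> i \<le> j \<Longrightarrow> j \<le> CARD('v) \<Longrightarrow> f (v j) \<le> f (v i)"
    and T: "T \<noteq> {}" "T \<noteq> UNIV"
    and upper: "\<And>u w. u \<in> T \<Longrightarrow> w \<notin> T \<Longrightarrow> f w < f u"
  shows "T \<in> sweep_sets v"
proof -
  define I where "I = {i \<in> {1..CARD('v)}. v i \<in> T}"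
  have T_eq: "T = v ` I"
  proof -
    have "u \<in> v ` I" if "u \<in> T" for u
    proof -
      obtain i where "i \<in> {1..CARD('v)}" "u = v i"
        using bij by (metis UNIV_I bij_betw_def imageE)
      then show ?thesis
        using that by (simp add: I_def)
    qed
    then show ?thesis
      by (auto simp: I_def)
  qed
  have fin: "finite I"
    by (simp add: I_def)
  have ne: "I \<noteq> {}"
    using T(1) T_eq by blast
  define k where "k = Max I"
  have k: "k \<in> I"
    unfolding k_def using fin ne by (rule Max_in)
  have "i \<in> I" if "1 \<le> i" "i \<le> k" for i
  proof (rule ccontr)
    assume "i \<notin> I"
    then have "f (v k) > f (v i)"
      using that k by (intro upper) (auto simp: I_def)
    moreover have "f (v k) \<le> f (v i)"
      using that k by (intro sorted) (auto simp: I_def)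
    ultimately show False by simp
  qed
  moreover have "1 \<le> i \<and> i \<le> k" if "i \<in> I" for i
    using that fin by (auto simp: k_def I_def)
  ultimately have I_eq: "I = {1..k}"
    by (intro set_eqI) (metis atLeastAtMost_iff)
  have "k \<noteq> CARD('v)"
    using T(2) bij unfolding T_eq I_eq bij_betw_def by blast
  then have "1 \<le> k" "k \<le> CARD('v) - 1"
    using k by (auto simp: I_def)
  then show ?thesis
    unfolding sweep_sets_def using T_eq I_eq by blast
qed

lemma sweep_set_nontrivial:
  fixes v :: "nat \<Rightarrow> 'v::finite"
  assumes "S \<in> sweep_sets v"
  shows "S \<noteq> {}" "S \<noteq> UNIV"
proof -
  obtain i where i: "S = v ` {1..i}" "1 \<le> i" "i \<le> CARD('v) - 1"
    using assms by (auto simp: sweep_sets_def)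
  then show "S \<noteq> {}" by auto
  have "card S \<le> i"
    using card_image_le[of "{1..i}" v] i by simp
  also have "i < CARD('v)"
    using i by linarith
  finally show "S \<noteq> UNIV" by auto
qed

text \<open>
  Scaling an eigenvector by the inverse square roots of the degrees turns it into a solution of
  \<open>L x = \<nu> D x\<close>, the form in which the clique expansion enters.
\<close>
lemma scaled_eigenvector:
  assumes H: "is_hypergraph H"
    and r: "normalized_laplacian H *v r = \<nu> *\<^sub>R r"
    and x: "x = degree_matrix_inv_sqrt H *v r"
  shows "(\<Sum>w\<in>UNIV. clique_weight H u w * (x $ u - x $ w)) = \<nu> * degree_of H u * x $ u"
proof -
  have d: "0 < degree_of H u" using H by (rule degree_pos)
  have "(\<Sum>w\<in>UNIV. clique_weight H u w * (x $ u - x $ w)) / sqrt (degree_of H u)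
      = (normalized_laplacian H *v r) $ u"
    unfolding normalized_laplacian_mult_vec x[symmetric] laplacian_mult_vec[OF H]
    by (simp add: degree_matrix_inv_sqrt_def diagonal_matrix_mult_vec)
  moreover have "r $ u = sqrt (degree_of H u) * x $ u"
    using d by (simp add: x degree_matrix_inv_sqrt_def diagonal_matrix_mult_vec)
  ultimately show ?thesis
    using d by (simp add: r divide_eq_eq)
qed

theorem mainTheorem7:
  fixes H :: "'v::finite hypergraph"
    and r x :: "real^'v"
    and v :: "nat \<Rightarrow> 'v"
    and S :: "'v set"
  assumes "is_hypergraph H"
    and "r \<noteq> 0"
    and "normalized_laplacian H *v r = nu H 2 *\<^sub>R r"
    and "orthogonal r (\<chi> u. sqrt (degree_of H u))"
    and "x = degree_matrix_inv_sqrt H *v r"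
    and "bij_betw v {1..CARD('v)} UNIV"
    and "\<And>i j. 1 \<le> i \<Longrightarrow> i \<le> j \<Longrightarrow> j \<le> CARD('v) \<Longrightarrow> x $ v i \<ge> x $ v j"
    and "is_arg_min (conductance H) (\<lambda>T. T \<in> sweep_sets v) S"
  shows "hypergraph_conductance H \<le> conductance H S \<and>
         conductance H S \<le> 2 * sqrt (hypergraph_diffusion_conductance H)"
proof
  note H = assms(1)
  let ?cuts = "{S. S \<noteq> {} \<and> S \<noteq> (UNIV :: 'v set)}"
  have S: "S \<in> sweep_sets v" and S_min: "\<And>T. T \<in> sweep_sets v \<Longrightarrow> conductance H S \<le> conductance H T"
    using assms(8) by (auto simp: is_arg_min_def not_less)
  have S_cut: "S \<in> ?cuts"
    using sweep_set_nontrivial[OF S] by simp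
  then show "hypergraph_conductance H \<le> conductance H S"
    unfolding hypergraph_conductance_def by (intro Min_le) auto
  have "hypergraph_diffusion_conductance H \<in> diffusion_conductance H ` ?cuts"
    unfolding hypergraph_diffusion_conductance_def using S_cut by (intro Min_in) auto
  then obtain T where "T \<in> ?cuts" "hypergraph_diffusion_conductance H = diffusion_conductance H T"
    by auto
  then have nu: "nu H 2 \<le> 2 * hypergraph_diffusion_conductance H"
    using nu_2_le_diffusion_conductance[OF H] by simp
  have r_x: "r $ u = sqrt (degree_of H u) * x $ u" for u
    using degree_pos[OF H, of u] by (simp add: assms(5) degree_matrix_inv_sqrt_def diagonal_matrix_mult_vec)
  obtain z where z: "x $ z \<noteq> 0"
    using assms(2) r_x by (auto simp: vec_eq_iff)
  have "degree_of H u * x $ u = r $ u * sqrt (degree_of H u)" for u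
    using degree_pos[OF H, of u] by (simp add: r_x)
  then have balanced: "(\<Sum>u\<in>UNIV. degree_of H u * x $ u) = 0"
    using assms(4) by (simp add: orthogonal_def inner_vec_def)
  have h: "0 \<le> conductance H S"
    using H S_cut unfolding conductance_def
    by (intro divide_nonneg_nonneg sum_nonneg)
      (auto simp: boundary_def is_hypergraph_def intro!: less_imp_le[OF vol_pos[OF H]])
  have sweep: "conductance H S * min (sum (degree_of H) T) (sum (degree_of H) (- T))
      \<le> cut_weight (clique_weight H) T"
    if T: "T \<noteq> {}" "T \<noteq> UNIV" and upper: "\<And>u w. u \<in> T \<Longrightarrow> w \<notin> T \<Longrightarrow> x $ w < x $ u" for T
  proof -
    have "0 < min (vol H T) (vol H (UNIV - T))"
      using T by (auto intro!: vol_pos H)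
    moreover have "conductance H S \<le> conductance H T"
      using assms(6,7) T upper by (intro S_min upper_set_in_sweep_sets[where f = "\<lambda>u. x $ u"])
    ultimately have "conductance H S * min (vol H T) (vol H (UNIV - T)) \<le> (\<Sum>e\<in>boundary H T. weight H e)"
      by (simp add: conductance_def[of H T] pos_le_divide_eq)
    then show ?thesis
      using boundary_weight_le_cut[OF H, of T] by (simp add: vol_def Compl_eq_Diff_UNIV)
  qed
  have "(conductance H S)\<^sup>2 \<le> 2 * nu H 2"
    by (rule cheeger_sweep[where f = "\<lambda>u. x $ u" and y = z, OF clique_weight_sym clique_weight_nonneg[OF H]
          clique_degree[OF H] degree_pos[OF H] scaled_eigenvector[OF H assms(3,5)] balanced z h sweep])
  also have "\<dots> \<le> 4 * hypergraph_diffusion_conductance H"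
    using nu by simp
  finally have "conductance H S \<le> sqrt (4 * hypergraph_diffusion_conductance H)"
    by (rule real_le_rsqrt)
  then show "conductance H S \<le> 2 * sqrt (hypergraph_diffusion_conductance H)"
    by (simp add: real_sqrt_mult)
qed

end
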